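(* Let $p$ be a prime and let $k,n$ be nonnegative integers such that $p\nmid 3n+2$. (1) If $p\equiv 1 \pmod 3$, then \[A_{3}\Big(p^kn+\frac{2p^{k}-2}{3}\Big)=\frac{p^{k+1}-1}{p-1}A_{3}(n).\] (2) If $p\equiv 2 \pmod 3$, then \[A_{3}\Big(p^{2k}n+\frac{2p^{2k}-2}{3}\Big)=\frac{p^{2k+1}-1}{p-1}A_{3}(n).\]
   Context: A partition $\lambda$ of a nonnegative integer is called a $3$-core if none of its hook lengths is divisible by $3$. $A_3(n)$ denotes the number of ordered pairs $(\lambda_1,\lambda_2)$ of partitions, each a $3$-core, whose sizes sum to $n$; equivalently $\sum_{n\ge0}A_3(n)q^n=\frac{(q^3;q^3)_\infty^{6}}{(q;q)_\infty^{2}}$, where $(a;q)_\infty=\prod_{k\ge0}(1-aq^k)$. *)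

theory Defs
  imports Complex_Main "HOL-Computational_Algebra.Primes"
begin

definition is_partition :: "nat list \<Rightarrow> bool" where
  "is_partition la \<longleftrightarrow> sorted_wrt (\<ge>) la \<and> (\<forall>x\<in>set la. 0 < x)"

text \<open>Hook length of the cell in row i, column j (0-indexed) of the Young diagram:
arm + leg + 1 = (la!i - j - 1) + #{i' > i. la!i' > j} + 1.\<close>
definition hook_length :: "nat list \<Rightarrow> nat \<Rightarrow> nat \<Rightarrow> nat" where
  "hook_length la i j = (la ! i - j) + card {i'. i < i' \<and> i' < length la \<and> j < la ! i'}"

definition cells :: "nat list \<Rightarrow> (nat \<times> nat) set" where
  "cells la = {(i, j). i < length la \<and> j < la ! i}"

definition is_t_core :: "nat \<Rightarrow> nat list \<Rightarrow> bool" where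
  "is_t_core t la \<longleftrightarrow> is_partition la \<and>
     (\<forall>(i, j)\<in>cells la. \<not> t dvd hook_length la i j)"

definition A3 :: "nat \<Rightarrow> nat" where
  "A3 n = card {(l1, l2). is_t_core 3 l1 \<and> is_t_core 3 l2 \<and> sum_list l1 + sum_list l2 = n}"

end

theory Submission
  imports Defs
begin

text \<open>
The bead set (first column hook lengths) of a 3-core is closed under subtracting 3, so it is given by
two runner lengths \<open>(i, j)\<close>, and the size of the core is \<open>i\<^sup>2 - i j + j\<^sup>2 + j\<close>. The elements
of norm \<open>3 n + 1\<close> of the Eisenstein integers fall into six rotated sectors, each a copy of the 3-cores
of \<open>n\<close>; hence \<open>36 A\<^sub>3(n)\<close> is the number of elements of norm \<open>3 n + 2\<close> in the maximal order
\<open>O = \<int>[\<omega>] + \<int>[\<omega>] j\<close> of the quaternion algebra of discriminant 3. This order is left Euclidean.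
For a prime \<open>p \<noteq> 3\<close> there are \<open>p + 1\<close> left ideals \<open>O w\<close> with \<open>N w = p\<close>; an element of norm
\<open>p m\<close> lies in exactly one of them unless it is divisible by \<open>p\<close>, when it lies in all of them.
Counting the incidences gives the Hecke relation \<open>r(p m) + p r(m / p) = (p + 1) r(m)\<close> for the number
\<open>r(m)\<close> of elements of norm \<open>m\<close>, and the theorem follows by induction on the exponent of \<open>p\<close>.
\<close>

subsection \<open>A quaternion order\<close>

text \<open>\<open>Quat a b c d\<close> stands for \<open>(a + b \<omega>) + (c + d \<omega>) j\<close>, where \<open>\<omega>\<^sup>2 = - 1 - \<omega>\<close>, \<open>j\<^sup>2 = - 1\<close> and
\<open>j \<alpha> = conj(\<alpha>) j\<close> for \<open>\<alpha> \<in> \<int>[\<omega>]\<close>.\<close>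
datatype quat = Quat (qa: int) (qb: int) (qc: int) (qd: int)

instantiation quat :: ring_1
begin

definition "0 = Quat 0 0 0 0"
definition "1 = Quat 1 0 0 0"
definition "x + y = Quat (qa x + qa y) (qb x + qb y) (qc x + qc y) (qd x + qd y)"
definition "x - y = Quat (qa x - qa y) (qb x - qb y) (qc x - qc y) (qd x - qd y)"
definition "- x = Quat (- qa x) (- qb x) (- qc x) (- qd x)"
definition "x * y = Quat
  (qa x * qa y - qb x * qb y - qc x * qc y + qc x * qd y - qd x * qd y)
  (qa x * qb y + qb x * qa y - qb x * qb y - qd x * qc y + qc x * qd y)
  (qa x * qc y - qb x * qd y + qc x * qa y - qc x * qb y + qd x * qb y)
  (qa x * qd y + qb x * qc y - qb x * qd y + qd x * qa y - qc x * qb y)"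

instance
proof
  fix x y z :: quat
  show "x * y * z = x * (y * z)"
    by (cases x; cases y; cases z) (simp add: times_quat_def algebra_simps)
  show "(x + y) * z = x * z + y * z" "x * (y + z) = x * y + x * z"
    by (cases x; cases y; cases z; simp add: times_quat_def plus_quat_def algebra_simps)+
qed (auto simp: zero_quat_def one_quat_def plus_quat_def minus_quat_def uminus_quat_def
      times_quat_def)

end

lemmas quat_defs = zero_quat_def one_quat_def plus_quat_def minus_quat_def uminus_quat_def
  times_quat_def

section \<open>Conjugation, trace and the positive definite norm form\<close>

definition qconj :: "quat \<Rightarrow> quat" where
  "qconj x = Quat (qa x - qb x) (- qb x) (- qc x) (- qd x)"

definition qtr :: "quat \<Rightarrow> int" where
  "qtr x = 2 * qa x - qb x"

definition qnorm :: "quat \<Rightarrow> int" where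
  "qnorm x = (qa x)\<^sup>2 - qa x * qb x + (qb x)\<^sup>2 + ((qc x)\<^sup>2 - qc x * qd x + (qd x)\<^sup>2)"

lemma of_nat_quat: "of_nat n = Quat (int n) 0 0 0"
  by (induction n) (auto simp: quat_defs)

lemma of_int_quat: "of_int n = Quat n 0 0 0"
  by (cases n rule: int_diff_cases) (simp add: of_nat_quat minus_quat_def)

lemma of_int_mult_quat: "of_int n * x = Quat (n * qa x) (n * qb x) (n * qc x) (n * qd x)"
  by (simp add: of_int_quat times_quat_def)

lemma of_int_comm_quat: "x * of_int n = of_int n * (x :: quat)"
  by (simp add: of_int_quat times_quat_def algebra_simps)

lemma of_int_left_comm_quat: "x * (of_int n * y) = of_int n * (x * y :: quat)"
  by (metis mult.assoc of_int_comm_quat)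

lemma qnorm_mult: "qnorm (x * y) = qnorm x * qnorm y"
  by (cases x; cases y) (simp add: qnorm_def times_quat_def power2_eq_square algebra_simps)

lemma qnorm_of_int [simp]: "qnorm (of_int n) = n\<^sup>2"
  by (simp add: of_int_quat qnorm_def)

lemma mult_qconj: "x * qconj x = of_int (qnorm x)"
  by (cases x)
     (simp add: qnorm_def times_quat_def qconj_def of_int_quat power2_eq_square algebra_simps)

lemma qconj_mult_self: "qconj x * x = of_int (qnorm x)"
  by (cases x)
     (simp add: qnorm_def times_quat_def qconj_def of_int_quat power2_eq_square algebra_simps)

lemma qnorm_qconj [simp]: "qnorm (qconj x) = qnorm x"
  by (cases x) (simp add: qnorm_def qconj_def power2_eq_square algebra_simps)

text \<open>Completing the square in either variable, 4 (a^2 - a b + b^2) = (2 a - b)^2 + 3 b^2,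
  gives definiteness. The last two bounds are crude, but they put the points of bounded norm into a
  finite box.\<close>

lemma eisenstein_norm_pos:
  fixes a b :: int
  shows "a\<^sup>2 - a * b + b\<^sup>2 \<ge> 0" and "a\<^sup>2 - a * b + b\<^sup>2 = 0 \<longleftrightarrow> a = 0 \<and> b = 0"
    and "\<bar>a\<bar> \<le> 2 * (a\<^sup>2 - a * b + b\<^sup>2)"  and "\<bar>b\<bar> \<le> 2 * (a\<^sup>2 - a * b + b\<^sup>2)"
proof -
  have 1: "4 * (a\<^sup>2 - a * b + b\<^sup>2) = (2 * a - b)\<^sup>2 + 3 * b\<^sup>2"
    "4 * (a\<^sup>2 - a * b + b\<^sup>2) = (2 * b - a)\<^sup>2 + 3 * a\<^sup>2"
    by (simp_all add: power2_eq_square algebra_simps)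
  have 2: "\<bar>x\<bar> \<le> x\<^sup>2" for x :: int
    by (metis abs_le_square_iff abs_of_nonneg power2_abs self_le_power abs_ge_zero
        int_one_le_iff_zero_less less_le order_refl pos2 power_zero_numeral)
  show "a\<^sup>2 - a * b + b\<^sup>2 \<ge> 0"
    using 1(1) zero_le_power2[of "2*a-b"] zero_le_power2[of b] by smt
  show "a\<^sup>2 - a * b + b\<^sup>2 = 0 \<longleftrightarrow> a = 0 \<and> b = 0"
    using 1 by (auto simp: sum_power2_eq_zero_iff)
       (smt (verit) zero_le_power2 zero_eq_power2)+
  show "\<bar>a\<bar> \<le> 2 * (a\<^sup>2 - a * b + b\<^sup>2)"  "\<bar>b\<bar> \<le> 2 * (a\<^sup>2 - a * b + b\<^sup>2)"
    using 1 2[of a] 2[of b] zero_le_power2[of "2*a-b"] zero_le_power2[of "2*b-a"] by linarith+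
qed

lemma qnorm_nonneg: "qnorm x \<ge> 0"
  unfolding qnorm_def by (intro add_nonneg_nonneg eisenstein_norm_pos)

lemma qnorm_eq_0_iff [simp]: "qnorm x = 0 \<longleftrightarrow> x = 0"
proof -
  have "qnorm x = 0 \<longleftrightarrow>
      (qa x)\<^sup>2 - qa x * qb x + (qb x)\<^sup>2 = 0 \<and> (qc x)\<^sup>2 - qc x * qd x + (qd x)\<^sup>2 = 0"
    unfolding qnorm_def
    using eisenstein_norm_pos(1)[of "qa x" "qb x"] eisenstein_norm_pos(1)[of "qc x" "qd x"] by linarith
  then show ?thesis
    unfolding eisenstein_norm_pos(2) by (cases x) (auto simp: zero_quat_def)
qed

lemma finite_eisenstein_norm: "finite {(a :: int, b). a\<^sup>2 - a * b + b\<^sup>2 \<le> m}"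
proof (rule finite_subset)
  show "{(a :: int, b). a\<^sup>2 - a * b + b\<^sup>2 \<le> m} \<subseteq> {-2*m..2*m} \<times> {-2*m..2*m}"
  proof clarify
    fix a b :: int
    assume "a\<^sup>2 - a * b + b\<^sup>2 \<le> m"
    then show "a \<in> {-2*m..2*m} \<and> b \<in> {-2*m..2*m}"
      using eisenstein_norm_pos(3,4)[of a b] eisenstein_norm_pos(4)[of b a] by auto
  qed
qed auto

lemma finite_qnorm: "finite {x. qnorm x = m}"
proof (rule finite_subset)
  let ?B = "{(a :: int, b). a\<^sup>2 - a * b + b\<^sup>2 \<le> m}"
  show "{x. qnorm x = m} \<subseteq> (\<lambda>((a, b), (c, d)). Quat a b c d) ` (?B \<times> ?B)"
  proof
    fix x
    assume "x \<in> {x. qnorm x = m}"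
    then have m: "qnorm x = m" by simp
    have "((qa x, qb x), (qc x, qd x)) \<in> ?B \<times> ?B"
      using m eisenstein_norm_pos(1)[of "qa x" "qb x"] eisenstein_norm_pos(1)[of "qc x" "qd x"]
      unfolding qnorm_def by auto
    then show "x \<in> (\<lambda>((a, b), (c, d)). Quat a b c d) ` (?B \<times> ?B)"
      by (rule rev_image_eqI) simp
  qed
  show "finite ((\<lambda>((a, b), (c, d)). Quat a b c d) ` (?B \<times> ?B))"
    by (intro finite_imageI finite_cartesian_product finite_eisenstein_norm)
qed

section \<open>Euclidean division in the order\<close>

lemma int_round:
  fixes B n :: int
  assumes "n > 0"
  obtains b where "2 * \<bar>B - n * b\<bar> \<le> n"
proof
  \<comment> \<open>The witness is the floor of B / n + 1/2, the integer nearest to B / n.\<close>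
  have "n * ((2 * B + n) div (2 * n)) * 2 + (2 * B + n) mod (2 * n) = 2 * B + n"
    using mult_div_mod_eq[of "2 * n" "2 * B + n"] by (simp add: mult_ac)
  moreover have "0 \<le> (2 * B + n) mod (2 * n)" "(2 * B + n) mod (2 * n) < 2 * n"
    using assms by auto
  ultimately show "2 * \<bar>B - n * ((2 * B + n) div (2 * n))\<bar> \<le> n"
    by (smt (verit))
qed

text \<open>The rounding errors give 4 N <= n^2 + 3 n^2 / 4. What matters is 7/16 < 1/2: division in
  the quaternion order adds two such errors, which must stay below \<open>n\<^sup>2\<close>
  together.\<close>

lemma eisenstein_round:
  fixes A B n :: int
  assumes "n > 0"
  obtains a b where "16 * ((A - n * a)\<^sup>2 - (A - n * a) * (B - n * b) + (B - n * b)\<^sup>2) \<le> 7 * n\<^sup>2"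
proof -
  \<comment> \<open>\<open>4 (X\<^sup>2 - X Y + Y\<^sup>2) = (2 X - Y)\<^sup>2 + 3 Y\<^sup>2\<close>, so round \<open>Y\<close> first and then \<open>2 X - Y\<close>\<close>
  obtain b where b: "2 * \<bar>B - n * b\<bar> \<le> n" using int_round[OF assms] .
  define Y where "Y = B - n * b"
  obtain a where a: "2 * \<bar>(2 * A - Y) - (2 * n) * a\<bar> \<le> 2 * n"
    using int_round[of "2 * n" "2 * A - Y"] assms by auto
  define X where "X = A - n * a"
  have "\<bar>2 * X - Y\<bar> \<le> \<bar>n\<bar>" "\<bar>2 * Y\<bar> \<le> \<bar>n\<bar>"
    using a b assms unfolding X_def Y_def abs_mult by (auto simp: algebra_simps)
  then have "(2 * X - Y)\<^sup>2 \<le> n\<^sup>2" "(2 * Y)\<^sup>2 \<le> n\<^sup>2"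
    by (simp_all only: abs_le_square_iff)
  then have "16 * (X\<^sup>2 - X * Y + Y\<^sup>2) \<le> 7 * n\<^sup>2"
    by (simp add: power2_eq_square algebra_simps)
  then show ?thesis using that unfolding X_def Y_def by blast
qed

text \<open>The quotient is \<open>w * qconj v\<close> divided by the norm of \<open>v\<close>, with
  both of its Eisenstein components rounded. The relative error in the norm is at most 7/16 + 7/16 <
  1.\<close>

lemma quat_euclid:
  assumes "v \<noteq> 0"
  obtains q where "qnorm (w - q * v) < qnorm v"
proof -
  define n where "n = qnorm v"
  have n: "n > 0" using assms qnorm_nonneg[of v] by (simp add: n_def less_le)
  define t where "t = w * qconj v"
  obtain a b where ab: "16 * ((qa t - n * a)\<^sup>2 - (qa t - n * a) * (qb t - n * b) + (qb t - n * b)\<^sup>2) \<le> 7 * n\<^sup>2"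
    using eisenstein_round[OF n] .
  obtain c d where cd: "16 * ((qc t - n * c)\<^sup>2 - (qc t - n * c) * (qd t - n * d) + (qd t - n * d)\<^sup>2) \<le> 7 * n\<^sup>2"
    using eisenstein_round[OF n] .
  define q where "q = Quat a b c d"
  have "16 * qnorm (t - of_int n * q) \<le> 14 * n\<^sup>2"
    using ab cd by (simp add: qnorm_def minus_quat_def of_int_mult_quat q_def)
  moreover have "n\<^sup>2 > 0" using n by simp
  ultimately have "qnorm (t - of_int n * q) < n\<^sup>2" by linarith
  moreover have "t - of_int n * q = (w - q * v) * qconj v"
    by (simp add: t_def n_def left_diff_distrib mult.assoc mult_qconj of_int_comm_quat)
  ultimately have "qnorm (w - q * v) * n < n * n"
    by (simp add: qnorm_mult n_def power2_eq_square)
  then show ?thesis using that n by (simp add: n_def)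
qed

subsection \<open>Left ideals of prime norm\<close>

definition qdvd :: "int \<Rightarrow> quat \<Rightarrow> bool" where
  "qdvd p x \<longleftrightarrow> (\<exists>y. x = of_int p * y)"

lemma qdvd_iff: "qdvd p x \<longleftrightarrow> p dvd qa x \<and> p dvd qb x \<and> p dvd qc x \<and> p dvd qd x"
proof
  assume "p dvd qa x \<and> p dvd qb x \<and> p dvd qc x \<and> p dvd qd x"
  then obtain a b c d where "qa x = p * a" "qb x = p * b" "qc x = p * c" "qd x = p * d"
    unfolding dvd_def by blast
  then have "x = of_int p * Quat a b c d" by (cases x) (simp add: of_int_mult_quat)
  then show "qdvd p x" unfolding qdvd_def by blast
qed (auto simp: qdvd_def of_int_mult_quat)

lemma qdvd_add: "qdvd p x \<Longrightarrow> qdvd p y \<Longrightarrow> qdvd p (x + y)"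
  and qdvd_diff: "qdvd p x \<Longrightarrow> qdvd p y \<Longrightarrow> qdvd p (x - y)"
  unfolding qdvd_def by (metis distrib_left, metis right_diff_distrib)

lemma qdvd_mult_left: "qdvd p x \<Longrightarrow> qdvd p (y * x)"
  unfolding qdvd_def by (metis of_int_left_comm_quat)

lemma qdvd_of_int_mult: "prime p \<Longrightarrow> qdvd p (of_int k * x) \<longleftrightarrow> p dvd k \<or> qdvd p x"
  by (auto simp: qdvd_iff of_int_mult_quat prime_dvd_mult_iff)

text \<open>This is the left ideal O x + p O, written as a congruence modulo p.\<close>

definition lideal :: "int \<Rightarrow> quat \<Rightarrow> quat set" where
  "lideal p x = {y. \<exists>u. qdvd p (y - u * x)}"

lemma in_lidealI: "qdvd p (y - u * x) \<Longrightarrow> y \<in> lideal p x"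
  by (auto simp: lideal_def)

lemma lideal_self: "x \<in> lideal p x"
  by (rule in_lidealI[of _ _ 1]) (simp add: qdvd_iff zero_quat_def)

lemma lideal_qdvd: "qdvd p y \<Longrightarrow> y \<in> lideal p x"
  by (rule in_lidealI[of _ _ 0]) simp

lemma lideal_diff: "y \<in> lideal p x \<Longrightarrow> z \<in> lideal p x \<Longrightarrow> y - z \<in> lideal p x"
proof -
  assume "y \<in> lideal p x" "z \<in> lideal p x"
  then obtain u v where "qdvd p (y - u * x)" "qdvd p (z - v * x)"
    by (auto simp: lideal_def)
  then have "qdvd p ((y - u * x) - (z - v * x))" by (rule qdvd_diff)
  then show ?thesis by (intro in_lidealI[of _ _ "u - v"]) (simp add: algebra_simps)
qed

lemma lideal_mult: "y \<in> lideal p x \<Longrightarrow> u * y \<in> lideal p x"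
proof -
  assume "y \<in> lideal p x"
  then obtain v where "qdvd p (y - v * x)" by (auto simp: lideal_def)
  then have "qdvd p (u * (y - v * x))" by (rule qdvd_mult_left)
  then show ?thesis by (intro in_lidealI[of _ _ "u * v"]) (simp add: algebra_simps)
qed

lemma lideal_subset: "y \<in> lideal p x \<Longrightarrow> lideal p y \<subseteq> lideal p x"
proof
  fix z assume y: "y \<in> lideal p x" and "z \<in> lideal p y"
  then obtain u where "qdvd p (z - u * y)" by (auto simp: lideal_def)
  then have "z - u * y \<in> lideal p x" by (rule lideal_qdvd)
  moreover have "0 - u * y \<in> lideal p x"
    using lideal_mult[OF y, of "- u"] by simp
  ultimately have "(z - u * y) - (0 - u * y) \<in> lideal p x" by (rule lideal_diff)
  then show "z \<in> lideal p x" by simp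
qed

text \<open>Polarisation: the cross term is p times a trace, so the norm modulo p depends only on
  the element modulo p.\<close>

lemma qnorm_add_of_int_mult: "p dvd qnorm (x + of_int p * y) \<longleftrightarrow> p dvd qnorm x"
proof -
  have "qnorm (x + of_int p * y) = qnorm x + p * (qtr (x * qconj y) + p * qnorm y)"
    by (cases x; cases y)
       (simp add: qnorm_def of_int_quat plus_quat_def qtr_def qconj_def times_quat_def
         power2_eq_square algebra_simps)
  then show ?thesis by (metis dvd_add_times_triv_right_iff mult.commute)
qed

lemma lideal_dvd_qnorm:
  assumes "p dvd qnorm x" "y \<in> lideal p x"
  shows "p dvd qnorm y"
proof -
  obtain u v where "y - u * x = of_int p * v" using assms(2) by (auto simp: lideal_def qdvd_def)
  then have "y = u * x + of_int p * v" by (simp add: algebra_simps)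
  then show ?thesis using assms(1) by (simp add: qnorm_add_of_int_mult qnorm_mult)
qed

lemma qnorm_1_unit: "qnorm s = 1 \<Longrightarrow> qconj s * (s * x) = x"
  by (metis mult.assoc mult_1 of_int_1 qconj_mult_self)

text \<open>By Euclidean division, a nonzero element \<open>w\<close> of least norm generates the
  ideal. Its norm divides p^2, since p lies in the ideal, and is divisible by p, since all norms in
  the ideal are. Norm p^2 would make the ideal equal to p O, which does not contain
  \<open>x\<close>.\<close>

lemma lideal_principal:
  assumes "prime p" "p dvd qnorm x" "\<not> qdvd p x"
  obtains w where "qnorm w = p" "lideal p x = range (\<lambda>u. u * w)"
proof -
  have p: "p > 1" using assms(1) by (simp add: prime_int_iff)
  define P where "P = (\<lambda>y. y \<in> lideal p x \<and> y \<noteq> 0)"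
  have "x \<noteq> 0" using assms(3) by (auto simp: qdvd_iff zero_quat_def)
  then have "P x" by (simp add: P_def lideal_self)
  define w where "w = arg_min (nat \<circ> qnorm) P"
  have w: "w \<in> lideal p x" "w \<noteq> 0"
    and min: "\<And>y. y \<in> lideal p x \<Longrightarrow> y \<noteq> 0 \<Longrightarrow> qnorm w \<le> qnorm y"
    using arg_min_nat_lemma[of P x "nat \<circ> qnorm", OF \<open>P x\<close>] qnorm_nonneg
    unfolding P_def w_def by (auto simp: nat_le_iff)
  have ideal: "y \<in> lideal p x \<longleftrightarrow> (\<exists>u. y = u * w)" for y
  proof
    assume y: "y \<in> lideal p x"
    obtain q where q: "qnorm (y - q * w) < qnorm w" using quat_euclid[OF w(2)] .
    have "y - q * w \<in> lideal p x" using y w lideal_diff lideal_mult by blast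
    then have "y - q * w = 0" using min q by (meson not_less)
    then show "\<exists>u. y = u * w" by auto
  qed (use w lideal_mult in blast)
  have "of_int p \<in> lideal p x"
    by (rule lideal_qdvd) (simp add: qdvd_iff of_int_quat)
  then obtain s where s: "of_int p = s * w" using ideal by blast
  have prod: "qnorm s * qnorm w = p\<^sup>2" using arg_cong[OF s, of qnorm] by (simp add: qnorm_mult)
  have "p dvd qnorm w" using lideal_dvd_qnorm assms(2) w by blast
  then obtain k where k: "qnorm w = p * k" by blast
  have "qnorm s * k = p" using prod p unfolding k power2_eq_square by simp
  then have "k dvd p" by (metis dvd_triv_right)
  moreover have "k \<ge> 0" using k qnorm_nonneg[of w] p by (metis not_less zero_le_mult_iff zero_less_one order.strict_trans)
  ultimately have "k = 1 \<or> k = p" using assms(1) by (auto simp: prime_int_iff)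
  \<comment> \<open>In this case the cofactor \<open>s\<close> in p = s w would be a unit, so p
    would divide \<open>w\<close> and hence \<open>x\<close>.\<close>
  moreover have "k \<noteq> p"
  proof
    assume "k = p"
    then have "qnorm s = 1" using \<open>qnorm s * k = p\<close> p by simp
    then have "w = qconj s * of_int p" using s qnorm_1_unit by metis
    then have "qdvd p w" by (metis of_int_comm_quat qdvd_def)
    moreover obtain u where "x = u * w" using ideal lideal_self by blast
    ultimately show False using assms(3) qdvd_mult_left by blast
  qed
  ultimately have "qnorm w = p" using k by simp
  then show ?thesis using that ideal by (auto simp: set_eq_iff)
qed

text \<open>Both ideals have generators of norm p. The inclusion makes one generator a left multiple
  of the other, and comparing norms makes the factor a unit.\<close>

lemma lideal_eqI:
  assumes "prime p" "p dvd qnorm x" "\<not> qdvd p x" "y \<in> lideal p x" "\<not> qdvd p y"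
  shows "lideal p y = lideal p x"
proof
  show "lideal p y \<subseteq> lideal p x" using assms by (intro lideal_subset)
  obtain w where w: "qnorm w = p" "lideal p x = range (\<lambda>u. u * w)"
    using lideal_principal assms by metis
  obtain w' where w': "qnorm w' = p" "lideal p y = range (\<lambda>u. u * w')"
    using lideal_principal assms lideal_dvd_qnorm by metis
  have p: "p > 1" using assms(1) by (simp add: prime_int_iff)
  have "w' = 1 * w'" by simp
  then have "w' \<in> lideal p y" unfolding w' by blast
  then have "w' \<in> lideal p x" using \<open>lideal p y \<subseteq> lideal p x\<close> by blast
  then obtain s where s: "w' = s * w" unfolding w by blast
  then have "qnorm s = 1" using arg_cong[OF s, of qnorm] w w' p by (simp add: qnorm_mult)
  then have w_eq: "w = qconj s * w'" using s qnorm_1_unit by metis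
  show "lideal p x \<subseteq> lideal p y"
    unfolding w w' using w_eq by (auto simp: mult.assoc[symmetric])
qed

text \<open>Right multiplication by a generator of norm p maps the elements of norm m bijectively to
  those of norm p m in the ideal.\<close>

lemma card_lideal_norm:
  assumes "prime p" "p dvd qnorm x" "\<not> qdvd p x"
  shows "card {v \<in> lideal p x. qnorm v = p * m} = card {v. qnorm v = m}"
proof -
  have p: "p > 1" using assms(1) by (simp add: prime_int_iff)
  obtain w where w: "qnorm w = p" "lideal p x = range (\<lambda>u. u * w)"
    using lideal_principal assms by metis
  have "qnorm (u * w) = p * m \<longleftrightarrow> qnorm u = m" for u
    using w(1) p by (simp add: qnorm_mult mult.commute del: qnorm_eq_0_iff)
  then have "{v \<in> lideal p x. qnorm v = p * m} = (\<lambda>u. u * w) ` {v. qnorm v = m}"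
    unfolding w(2) by blast
  moreover have "inj (\<lambda>u. u * w)"
  proof (rule injI)
    fix u v assume "u * w = v * w"
    then have "qnorm (u - v) * qnorm w = 0" by (simp add: left_diff_distrib flip: qnorm_mult)
    then show "u = v" using w(1) p by auto
  qed
  ultimately show ?thesis by (simp add: card_image inj_on_subset)
qed

section \<open>Counting the left ideals of prime norm\<close>

text \<open>Pigeonhole for odd p: multiplied by 4, the condition reads (2 s - t)^2 + 3 t^2 + 4 = 0
  modulo p, and \<open>a\<^sup>2\<close> and \<open>- 4 - 3 * b\<^sup>2\<close> take (p + 1) / 2
  values each, so they share one.\<close>

lemma ex_eisenstein_norm_minus_1:
  assumes "prime (p :: int)" "p \<noteq> 3"
  shows "\<exists>s t. p dvd 1 + (s\<^sup>2 - s * t + t\<^sup>2)"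
proof (cases "p = 2")
  case True
  then show ?thesis by (intro exI[of _ 1] exI[of _ 0]) simp
next
  case False
  define h where "h = (p - 1) div 2"
  have "p > 1" using assms(1) by (simp add: prime_int_iff)
  moreover have "odd p" using False assms(1) prime_odd_int[of p] \<open>p > 1\<close> by auto
  ultimately have h: "p = 2 * h + 1" "h \<ge> 1" unfolding h_def by presburger+
  \<comment> \<open>For a and b in 0..h both a - b and a + b are smaller than p = 2 h + 1 in
    absolute value. The factor c serves the two uses, with 1 and with 3.\<close>
  have inj: "a = b" if "p dvd c * (a\<^sup>2 - b\<^sup>2)" "\<not> p dvd c" "a \<in> {0..h}" "b \<in> {0..h}" for a b c :: int
  proof -
    have "p dvd c * ((a - b) * (a + b))"
      using that by (simp add: power2_eq_square algebra_simps)
    then have "p dvd a - b \<or> p dvd a + b"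
      using assms(1) that(2) by (simp add: prime_dvd_mult_iff)
    then show ?thesis
    proof
      assume "p dvd a - b"
      then show ?thesis using that(3,4) h zdvd_imp_le[of p "\<bar>a - b\<bar>"] by (cases "a = b") auto
    next
      assume "p dvd a + b"
      then show ?thesis using that(3,4) h zdvd_imp_le[of p "a + b"] by (cases "a + b = 0") auto
    qed
  qed
  have p3: "\<not> p dvd 3"
    using assms primes_dvd_imp_eq[of p 3] by (auto simp: prime_int_numeral_eq)
  define f where "f = (\<lambda>a. a\<^sup>2 mod p)"
  define g where "g = (\<lambda>b. (- 4 - 3 * b\<^sup>2) mod p)"
  have "inj_on f {0..h}"
    by (rule inj_onI) (use inj[of 1] \<open>p > 1\<close> in \<open>auto simp: f_def mod_eq_dvd_iff\<close>)
  moreover have "inj_on g {0..h}"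
  proof (rule inj_onI)
    fix a b assume ab: "a \<in> {0..h}" "b \<in> {0..h}" "g a = g b"
    then have "p dvd 3 * (b\<^sup>2 - a\<^sup>2)" by (simp add: g_def mod_eq_dvd_iff algebra_simps)
    then show "a = b" using inj[of 3 b a] p3 ab by simp
  qed
  ultimately have "card (f ` {0..h}) + card (g ` {0..h}) = nat (p + 1)"
    using h by (simp add: card_image)
  moreover have "f ` {0..h} \<union> g ` {0..h} \<subseteq> {0..<p}"
    using \<open>p > 1\<close> by (auto simp: f_def g_def)
  then have "card (f ` {0..h} \<union> g ` {0..h}) \<le> nat p"
    using card_mono[of "{0..<p}"] by force
  ultimately have "f ` {0..h} \<inter> g ` {0..h} \<noteq> {}"
    using card_Un_disjoint[of "f ` {0..h}" "g ` {0..h}"] h by auto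
  then obtain a b where "f a = g b" by blast
  then have ab: "p dvd a\<^sup>2 + 3 * b\<^sup>2 + 4"
    by (simp add: f_def g_def mod_eq_dvd_iff algebra_simps)
  \<comment> \<open>\<open>h + 1\<close> is the inverse of 2 modulo \<open>p\<close>\<close>
  define s where "s = (a + b) * (h + 1)"
  have "4 * (1 + (s\<^sup>2 - s * b + b\<^sup>2)) = (2 * s - b)\<^sup>2 + 3 * b\<^sup>2 + 4"
    by (simp add: power2_eq_square algebra_simps)
  moreover have "2 * s - b = a + p * (a + b)"
    by (simp add: s_def h algebra_simps)
  moreover have "(a + p * (a + b))\<^sup>2 = a\<^sup>2 + p * ((a + b) * (2 * a + p * (a + b)))"
    by (simp add: power2_eq_square algebra_simps)
  ultimately have "4 * (1 + (s\<^sup>2 - s * b + b\<^sup>2)) = a\<^sup>2 + 3 * b\<^sup>2 + 4 + p * ((a + b) * (2 * a + p * (a + b)))"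
    by simp
  then have "p dvd 4 * (1 + (s\<^sup>2 - s * b + b\<^sup>2))"
    using ab by (metis dvd_add dvd_triv_left)
  moreover have "coprime p 4"
    using \<open>odd p\<close> coprime_power_right_iff[of p 2 2] by (simp add: coprime_commute)
  ultimately have "p dvd 1 + (s\<^sup>2 - s * b + b\<^sup>2)"
    using coprime_dvd_mult_right_iff by blast
  then show ?thesis by blast
qed


text \<open>These represent the nonzero isotropic vectors of the norm form on O / p O.\<close>

definition isotropic :: "int \<Rightarrow> quat \<Rightarrow> bool" where
  "isotropic p x \<longleftrightarrow> p dvd qnorm x \<and> \<not> qdvd p x"

definition norm_ideals :: "int \<Rightarrow> quat set set" where
  "norm_ideals p = lideal p ` {x. isotropic p x}"

text \<open>This is the quadratic equation of x u, namely (x u)^2 = tr(x u) x u - N(x) N(u), with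
  the right factor u cancelled.\<close>

lemma qtr_sandwich: "x * u * x = of_int (qtr (x * u)) * x - of_int (qnorm x) * qconj u"
  by (cases x; cases u)
     (simp add: of_int_quat qtr_def qnorm_def qconj_def minus_quat_def times_quat_def
       power2_eq_square algebra_simps)

text \<open>With \<open>N \<zeta> = - 1\<close> modulo \<open>p\<close>, every ideal in question is generated by some element of
\<open>e \<int>[\<omega>] = e O\<close> (modulo \<open>p\<close>), where \<open>e = 1 + \<zeta> j\<close>. Since \<open>e u e = tr(e u) e\<close> modulo \<open>p\<close> and
\<open>tr(e \<omega>) = - 1\<close>, two elements of \<open>e \<int>[\<omega>]\<close> generate the same ideal iff they are proportional
over the integers modulo \<open>p\<close>, so the \<open>p\<^sup>2 - 1\<close> nonzero ones give \<open>p + 1\<close> ideals.\<close>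
lemma card_norm_ideals:
  assumes "prime p" "p \<noteq> 3"
  shows "finite (norm_ideals p)" "card (norm_ideals p) = nat p + 1"
proof -
  have p: "p > 1" using assms(1) by (simp add: prime_int_iff)
  have p3: "\<not> p dvd 3"
    using assms primes_dvd_imp_eq[of p 3] by (auto simp: prime_int_numeral_eq)
  obtain s t where st: "p dvd 1 + (s\<^sup>2 - s * t + t\<^sup>2)" using ex_eisenstein_norm_minus_1[OF assms] by blast
  define e where "e = Quat 1 0 s t"
  define om where "om = Quat 0 1 0 0"
  have e: "p dvd qnorm e" using st by (simp add: e_def qnorm_def)
  define F where "F = (\<lambda>(a, b). e * Quat a b 0 0)"
  have F: "F (a, b) = Quat a b (s * a - s * b + t * b) (t * a - s * b)" for a b
    by (simp add: F_def e_def times_quat_def)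
  \<comment> \<open>The first two coordinates of \<open>F (a, b)\<close> are a and b themselves, so
    \<open>F\<close> is injective modulo p.\<close>
  have F_dvd: "qdvd p (F (a, b)) \<longleftrightarrow> p dvd a \<and> p dvd b" for a b
    by (auto simp: F qdvd_iff intro: dvd_add dvd_diff)
  define D where "D = {0..<p} \<times> {0..<p} - {(0, 0)}"
  have iso: "isotropic p (F w)" if "w \<in> D" for w
  proof -
    obtain a b where w: "w = (a, b)" by fastforce
    have "\<not> (p dvd a \<and> p dvd b)"
      using that zdvd_imp_le[of p a] zdvd_imp_le[of p b] by (auto simp: D_def w)
    moreover have "p dvd qnorm (F w)" using e by (simp add: F_def w qnorm_mult)
    ultimately show ?thesis by (simp add: isotropic_def w F_dvd)
  qed
  have reduce: "qdvd p (F (a, b) - F (a mod p, b mod p))" for a b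
  proof -
    have "F (a, b) - F (a mod p, b mod p) = F (a - a mod p, b - b mod p)"
      by (simp add: F minus_quat_def algebra_simps)
    then show ?thesis by (simp add: F_dvd minus_mod_eq_mult_div)
  qed
  have image: "norm_ideals p = (lideal p \<circ> F) ` D"
  proof (intro equalityI subsetI)
    fix L assume "L \<in> norm_ideals p"
    then obtain w where w: "isotropic p w" "L = lideal p w" by (auto simp: norm_ideals_def)
    \<comment> \<open>Otherwise p divides e w and e \<omega> w. The combination conj(\<omega>) e - e
      \<omega> = - (1 + 2 \<omega>) is free of j, and (1 + 2 \<omega>)^2 = - 3, so p would divide 3
      w and hence w.\<close>
    have "\<exists>u. \<not> qdvd p (e * u * w)"
    proof (rule ccontr)
      assume "\<not> ?thesis"
      then have "qdvd p (e * 1 * w)" "qdvd p (e * om * w)" by blast+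
      then have "qdvd p (qconj om * (e * 1 * w) - e * om * w)"
        by (rule qdvd_diff[OF qdvd_mult_left])
      moreover have "qconj om * e - e * om = Quat (-1) (-2) 0 0"
        by (simp add: e_def om_def qconj_def times_quat_def minus_quat_def)
      then have "qconj om * (e * 1 * w) - e * om * w = Quat (-1) (-2) 0 0 * w"
        by (metis left_diff_distrib mult.assoc mult_1_right)
      ultimately have "qdvd p (Quat 1 2 0 0 * (Quat (-1) (-2) 0 0 * w))" by (simp add: qdvd_mult_left)
      moreover have "Quat 1 2 0 0 * (Quat (-1) (-2) 0 0 * w) = of_int 3 * w"
        by (cases w) (simp add: times_quat_def of_int_quat algebra_simps)
      ultimately have "qdvd p w" using p3 assms(1) qdvd_of_int_mult by metis
      then show False using w by (simp add: isotropic_def)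
    qed
    then obtain u where u: "\<not> qdvd p (e * u * w)" ..
    define y where "y = e * u * w"
    define a b where "a = qa y" and "b = qb y"
    \<comment> \<open>Since e O = e \<int>[\<omega>] modulo p, the element \<open>y\<close> is
      determined modulo p by its first two coordinates.\<close>
    have "qdvd p (y - F (a, b))"
    proof -
      define z where "z = u * w"
      have y: "y = e * z" by (simp add: y_def z_def mult.assoc)
      have "y - F (a, b) = of_int (1 + (s\<^sup>2 - s * t + t\<^sup>2)) * Quat 0 0 (qc z) (qd z)"
        by (cases z) (simp add: a_def b_def F y e_def times_quat_def minus_quat_def of_int_quat
            power2_eq_square algebra_simps)
      then show ?thesis using st by (simp add: qdvd_iff of_int_quat times_quat_def)
    qed
    then have "qdvd p ((y - F (a, b)) + (F (a, b) - F (a mod p, b mod p)))"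
      using reduce by (rule qdvd_add)
    then have yF: "qdvd p (y - F (a mod p, b mod p))" by simp
    define v where "v = F (a mod p, b mod p)"
    have nd: "\<not> qdvd p v"
      using u yF qdvd_add[of p "y - v" v] by (auto simp: y_def v_def)
    have "v \<in> lideal p w"
    proof -
      have "y \<in> lideal p w" unfolding y_def mult.assoc by (intro lideal_mult lideal_self)
      moreover have "y - v \<in> lideal p w" using yF v_def lideal_qdvd by simp
      ultimately have "y - (y - v) \<in> lideal p w" by (rule lideal_diff)
      then show ?thesis by simp
    qed
    then have "lideal p v = lideal p w"
      using w nd assms(1) by (intro lideal_eqI) (auto simp: isotropic_def)
    moreover have "(a mod p, b mod p) \<in> D"
      using nd p by (auto simp: D_def v_def F_dvd)
    ultimately show "L \<in> (lideal p \<circ> F) ` D" using w by (auto simp: v_def)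
  qed (use iso in \<open>auto simp: norm_ideals_def\<close>)
  \<comment> \<open>The fibre over an ideal consists of the p - 1 nonzero scalar multiples of
    \<open>w\<close>, reduced modulo p; \<open>m k\<close> is the multiple by k.\<close>
  have fib: "card {x \<in> D. (lideal p \<circ> F) x = (lideal p \<circ> F) w} = nat (p - 1)" if w: "w \<in> D" for w
  proof -
    obtain a b where ab: "w = (a, b)" by fastforce
    define m where "m = (\<lambda>k. (k * a mod p, k * b mod p))"
    have isow: "p dvd qnorm (F w)" "\<not> qdvd p (F w)" using iso[OF w] by (auto simp: isotropic_def)
    have Fm: "qdvd p (F (m k) - of_int k * F w)" for k
    proof -
      have "of_int k * F w = F (k * a, k * b)"
        by (simp add: ab F of_int_quat times_quat_def algebra_simps)
      then have "F (m k) - of_int k * F w = - 1 * (F (k * a, k * b) - F (k * a mod p, k * b mod p))"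
        by (simp add: m_def)
      then show ?thesis using reduce qdvd_mult_left by metis
    qed
    have "{x \<in> D. (lideal p \<circ> F) x = (lideal p \<circ> F) w} = m ` {1..<p}"
    proof (intro equalityI subsetI)
      fix x assume "x \<in> {x \<in> D. (lideal p \<circ> F) x = (lideal p \<circ> F) w}"
      then have x: "x \<in> D" "lideal p (F x) = lideal p (F w)" by auto
      obtain a' b' where x': "x = (a', b')" by fastforce
      obtain u where u: "qdvd p (F x - u * F w)"
        using lideal_self[of "F x" p] unfolding x(2) by (auto simp: lideal_def)
      \<comment> \<open>Multiplying F x = u F w (modulo p) on the left by e \<omega> turns both
        sides into scalar multiples: the left becomes - F x, as tr(e \<omega>) = - 1, and the right
        becomes c F w.\<close>
      define c where "c = qtr (e * (om * u))"
      have tr: "qtr (e * om) = - 1" by (simp add: e_def om_def qtr_def times_quat_def)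
      have "e * om * F x = e * om * e * Quat a' b' 0 0"
        by (simp add: x' F_def mult.assoc)
      also have "\<dots> = - F x - of_int (qnorm e) * (qconj om * Quat a' b' 0 0)"
        unfolding qtr_sandwich tr by (simp add: x' F_def left_diff_distrib mult.assoc)
      finally have 1: "e * om * F x = - F x - of_int (qnorm e) * (qconj om * Quat a' b' 0 0)" .
      have "e * om * (u * F w) = e * (om * u) * e * Quat a b 0 0"
        by (simp add: ab F_def mult.assoc)
      also have "\<dots> = of_int c * F w - of_int (qnorm e) * (qconj (om * u) * Quat a b 0 0)"
        unfolding qtr_sandwich c_def by (simp add: ab F_def left_diff_distrib mult.assoc)
      finally have 2: "e * om * (u * F w) = of_int c * F w - of_int (qnorm e) * (qconj (om * u) * Quat a b 0 0)" .
      have "qdvd p (e * om * (F x - u * F w))" using u by (rule qdvd_mult_left)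
      moreover have "qdvd p (of_int (qnorm e) * v)" for v
        using e by (simp add: qdvd_iff of_int_mult_quat)
      ultimately have "qdvd p (e * om * (F x - u * F w) + of_int (qnorm e) * (qconj om * Quat a' b' 0 0 -
           qconj (om * u) * Quat a b 0 0))" by (intro qdvd_add)
      also have "e * om * (F x - u * F w) + of_int (qnorm e) * (qconj om * Quat a' b' 0 0 -
           qconj (om * u) * Quat a b 0 0) = - F x - of_int c * F w"
        unfolding right_diff_distrib[of "e * om"] 1 2 by (simp add: algebra_simps)
      finally have "qdvd p (- F x - of_int c * F w)" .
      then have "p dvd - a' - c * a" "p dvd - b' - c * b"
        by (simp_all add: x' ab F qdvd_iff of_int_quat quat_defs)
      then have "p dvd - c * a - a'" "p dvd - c * b - b'"
        by (metis diff_minus_eq_add dvd_minus_iff minus_diff_eq minus_mult_left uminus_add_conv_diff diff_diff_eq2 add.commute)+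
      then have mods: "- c * a mod p = a' mod p" "- c * b mod p = b' mod p"
        by (simp_all add: mod_eq_dvd_iff)
      have small: "a' mod p = a'" "b' mod p = b'" using x(1) by (auto simp: D_def x')
      define k where "k = (- c) mod p"
      have "m k = (a', b')"
        using mods small by (simp add: m_def k_def mod_mult_left_eq)
      moreover have "k \<noteq> 0"
      proof
        assume "k = 0"
        then have "(a', b') = (0, 0)" using \<open>m k = (a', b')\<close> by (simp add: m_def)
        then show False using x(1) by (simp add: D_def x')
      qed
      then have "k \<in> {1..<p}" using p pos_mod_bound[of p "- c"] pos_mod_sign[of p "- c"]
        unfolding k_def by (auto simp del: pos_mod_bound pos_mod_sign)
      ultimately show "x \<in> m ` {1..<p}" using x' by (metis imageI)
    next
      fix x assume "x \<in> m ` {1..<p}"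
      then obtain k where k: "k \<in> {1..<p}" "x = m k" by blast
      have "\<not> p dvd k" using k zdvd_not_zless[of k p] by auto
      then have nd: "\<not> qdvd p (of_int k * F w)" using isow assms(1) qdvd_of_int_mult by blast
      then have nd': "\<not> qdvd p (F x)"
        using Fm[of k] qdvd_diff[of p "F x" "F x - of_int k * F w"] by (auto simp: k)
      have "F x \<in> lideal p (F w)"
        using Fm[of k] k by (auto intro: in_lidealI)
      then have "lideal p (F x) = lideal p (F w)"
        using isow nd' assms(1) by (intro lideal_eqI)
      moreover have "x \<in> D" using nd' p by (auto simp: k m_def D_def F_dvd)
      ultimately show "x \<in> {x \<in> D. (lideal p \<circ> F) x = (lideal p \<circ> F) w}" by simp
    qed
    moreover have "inj_on m {1..<p}"
    proof (rule inj_onI)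
      fix k l assume kl: "k \<in> {1..<p}" "l \<in> {1..<p}" "m k = m l"
      have "qdvd p ((F (m k) - of_int k * F w) - (F (m l) - of_int l * F w))"
        by (intro qdvd_diff Fm)
      then have "qdvd p (of_int (l - k) * F w)" unfolding kl(3) by (simp add: left_diff_distrib)
      then have "p dvd l - k" using isow assms(1) qdvd_of_int_mult by blast
      then show "k = l" using kl(1,2) zdvd_imp_le[of p "\<bar>l - k\<bar>"] by (cases "k = l") auto
    qed
    ultimately show ?thesis by (simp add: card_image)
  qed
  have finD: "finite D" by (simp add: D_def)
  show "finite (norm_ideals p)" unfolding image using finD by blast
  \<comment> \<open>Counting by fibres: p^2 - 1 points, p - 1 over each ideal.\<close>
  have "card D = (\<Sum>L\<in>(lideal p \<circ> F) ` D. card {x \<in> D. (lideal p \<circ> F) x = L})"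
    using sum.image_gen[OF finD, of "\<lambda>_. 1 :: nat" "lideal p \<circ> F"] by simp
  also have "\<dots> = card (norm_ideals p) * nat (p - 1)"
    unfolding image by (subst sum.cong[OF refl, of _ _ "\<lambda>_. nat (p - 1)"]) (use fib in auto)
  finally have "card D = card (norm_ideals p) * nat (p - 1)" .
  moreover have "card D = nat p * nat p - 1"
    using p by (simp add: D_def card_Diff_singleton_if card_cartesian_product)
  moreover have "nat p * nat p - 1 = (nat p + 1) * nat (p - 1)"
    using p by (cases p rule: int_cases) (auto simp: algebra_simps nat_diff_distrib diff_mult_distrib2)
  ultimately have "card (norm_ideals p) * nat (p - 1) = (nat p + 1) * nat (p - 1)" by simp
  then show "card (norm_ideals p) = nat p + 1" using p by (subst (asm) mult_cancel2) auto
qed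

subsection \<open>The Hecke relation\<close>

definition rep :: "int \<Rightarrow> nat" where
  "rep m = card {x. qnorm x = m}"

text \<open>Incidences of elements of norm p m with ideals are counted in two ways. The multiples of
  p enter as a cardinality rather than as r(m / p), which also covers m not divisible by p.\<close>

lemma rep_hecke:
  assumes "prime p" "p \<noteq> 3"
  shows "rep (p * m) + nat p * card {x. qnorm x = p * m \<and> qdvd p x} = (nat p + 1) * rep m"
proof -
  define A where "A = {x. qnorm x = p * m}"
  define A0 where "A0 = {x \<in> A. qdvd p x}"
  define A1 where "A1 = {x \<in> A. \<not> qdvd p x}"
  have fin: "finite A" "finite A0" "finite A1"
    using finite_qnorm[of "p * m"] by (auto simp: A_def A0_def A1_def)
  have A: "A = A1 \<union> A0" "A1 \<inter> A0 = {}" by (auto simp: A0_def A1_def)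
  have iso: "isotropic p x" if "x \<in> A1" for x
    using that by (simp add: A1_def A_def isotropic_def)
  have L: "card {v \<in> L. qnorm v = p * m} = rep m" and L0: "A0 \<subseteq> L"
    and L1: "\<And>x. x \<in> A1 \<inter> L \<Longrightarrow> L = lideal p x" if LN: "L \<in> norm_ideals p" for L
  proof -
    obtain y where y: "L = lideal p y" "p dvd qnorm y" "\<not> qdvd p y"
      using LN by (auto simp: norm_ideals_def isotropic_def)
    show "card {v \<in> L. qnorm v = p * m} = rep m"
      unfolding y(1) rep_def by (rule card_lideal_norm[OF assms(1) y(2,3)])
    show "A0 \<subseteq> L" by (auto simp: y A0_def intro: lideal_qdvd)
    show "L = lideal p x" if "x \<in> A1 \<inter> L" for x
      using that lideal_eqI[OF assms(1) y(2,3), of x] by (simp add: y(1) A1_def)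
  qed
  have cardL: "rep m = card (A1 \<inter> L) + card A0" if "L \<in> norm_ideals p" for L
  proof -
    have "{v \<in> L. qnorm v = p * m} = (A1 \<inter> L) \<union> A0"
      using L0[OF that] A by (auto simp: A_def)
    moreover have "card ((A1 \<inter> L) \<union> A0) = card (A1 \<inter> L) + card A0"
      using fin A by (intro card_Un_disjoint) auto
    ultimately show ?thesis using L[OF that] by simp
  qed
  have "A1 = (\<Union>L\<in>norm_ideals p. A1 \<inter> L)"
    using iso lideal_self by (fastforce simp: norm_ideals_def)
  then have "card A1 = card (\<Union>L\<in>norm_ideals p. A1 \<inter> L)" by simp
  also have "\<dots> = (\<Sum>L\<in>norm_ideals p. card (A1 \<inter> L))"
  proof (rule card_UN_disjoint)
    show "finite (norm_ideals p)" by (rule card_norm_ideals[OF assms])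
    show "\<forall>L\<in>norm_ideals p. \<forall>M\<in>norm_ideals p. L \<noteq> M \<longrightarrow> (A1 \<inter> L) \<inter> (A1 \<inter> M) = {}"
      using L1 by blast
  qed (use fin in simp)
  finally have "card A1 + (nat p + 1) * card A0 = (\<Sum>L\<in>norm_ideals p. card (A1 \<inter> L) + card A0)"
    by (simp add: sum.distrib card_norm_ideals[OF assms])
  also have "\<dots> = (\<Sum>L\<in>norm_ideals p. rep m)"
    using cardL by (intro sum.cong) auto
  also have "\<dots> = (nat p + 1) * rep m"
    by (simp add: card_norm_ideals[OF assms])
  finally have "card A1 + (nat p + 1) * card A0 = (nat p + 1) * rep m" .
  moreover have "rep (p * m) = card A1 + card A0"
    unfolding rep_def A_def[symmetric] A(1) by (intro card_Un_disjoint fin A)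
  moreover have "{x. qnorm x = p * m \<and> qdvd p x} = A0" by (auto simp: A0_def A_def)
  ultimately show ?thesis by (simp add: algebra_simps)
qed

lemma rep_qdvd:
  assumes "p > 0"
  shows "card {x. qnorm x = p * (p * m) \<and> qdvd p x} = rep m"
proof -
  have "{x. qnorm x = p * (p * m) \<and> qdvd p x} = (\<lambda>y. of_int p * y) ` {y. qnorm y = m}"
    using assms by (auto simp: qdvd_def qnorm_mult power2_eq_square)
  moreover have "inj (\<lambda>y :: quat. of_int p * y)"
    using assms by (auto simp: inj_def of_int_mult_quat quat.expand)
  ultimately show ?thesis by (simp add: card_image inj_on_subset rep_def)
qed

text \<open>The sums S(k) = 1 + p + ... + p^k satisfy the recurrence S(k + 2) + p S(k) = (p + 1) S(k
  + 1) that the Hecke relation imposes.\<close>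

lemma rep_prime_power:
  assumes "prime p" "p \<noteq> 3" "\<not> p dvd m"
  shows "rep (p ^ k * m) = (\<Sum>i<k+1. nat p ^ i) * rep m"
proof -
  have p: "p > 1" using assms(1) by (simp add: prime_int_iff)
  define S where "S k = (\<Sum>i<k+1. nat p ^ i)" for k
  have S: "S (Suc k) = 1 + nat p * S k" for k
    unfolding S_def Suc_eq_plus1[symmetric] by (subst sum.lessThan_Suc_shift) (simp add: sum_distrib_left distrib_left)
  have "rep (p ^ k * m) = S k * rep m"
  proof (induction k rule: less_induct)
    case (less k)
    consider "k = 0" | "k = 1" | l where "k = Suc (Suc l)"
      by (metis One_nat_def not0_implies_Suc)
    then show ?case
    proof cases
      case 1
      then show ?thesis by (simp add: S_def)
    next
      case 2
      \<comment> \<open>A multiple of p has norm divisible by p^2, which would force p to divide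
        m.\<close>
      have no: "{x. qnorm x = p * m \<and> qdvd p x} = {}"
        using assms(3) p by (auto simp: qdvd_def qnorm_mult power2_eq_square)
      show ?thesis using rep_hecke[OF assms(1,2), of m] unfolding no by (simp add: 2 S_def)
    next
      case 3
      have "rep (p * (p * (p ^ l * m))) + nat p * rep (p ^ l * m) = (nat p + 1) * rep (p * (p ^ l * m))"
        using rep_hecke[OF assms(1,2), of "p * (p ^ l * m)"] rep_qdvd[of p "p ^ l * m"] p by simp
      then have "rep (p ^ k * m) + nat p * (S l * rep m) = (nat p + 1) * (S (Suc l) * rep m)"
        using less[of l] less[of "Suc l"] by (simp add: 3 mult.assoc)
      then show ?thesis by (simp add: 3 S algebra_simps)
    qed
  qed
  then show ?thesis by (simp add: S_def)
qed

subsection \<open>Bead sets\<close>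

fun beads :: "nat list \<Rightarrow> nat set" where
  "beads [] = {}"
| "beads (x # xs) = insert (x + length xs) (beads xs)"

text \<open>The length of column \<open>j\<close> of the Young diagram.\<close>
definition col :: "nat list \<Rightarrow> nat \<Rightarrow> nat" where
  "col la j = length (filter ((<) j) la)"

lemma is_partition_Cons:
  "is_partition (x # xs) \<longleftrightarrow> is_partition xs \<and> 0 < x \<and> (\<forall>y\<in>set xs. y \<le> x)"
  by (auto simp: is_partition_def)

lemma col_eq_0: "\<forall>y\<in>set la. y \<le> j \<Longrightarrow> col la j = 0"
  by (auto simp: col_def filter_empty_conv)

lemma beads_less: "\<forall>y\<in>set la. y \<le> m \<Longrightarrow> h \<in> beads la \<Longrightarrow> h < m + length la"
  by (induction la) auto

text \<open>The gaps of the bead set correspond to the columns of the diagram, which makes the hook lengths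
of the first row the distances from the largest bead to the gaps below it.\<close>
lemma not_in_beads_iff:
  "is_partition la \<Longrightarrow> y \<notin> beads la \<longleftrightarrow> (\<exists>j. y + col la j = j + length la)"
proof (induction la)
  case (Cons x xs)
  have IH: "y \<notin> beads xs \<longleftrightarrow> (\<exists>j. y + col xs j = j + length xs)"
    using Cons by (simp add: is_partition_Cons)
  have x: "\<forall>z\<in>set xs. z \<le> x" using Cons by (simp add: is_partition_Cons)
  have 0: "col xs j = 0" if "j \<ge> x" for j
    using x that by (intro col_eq_0) auto
  have c: "col (x # xs) j = (if j < x then Suc (col xs j) else 0)" for j
    using 0[of j] by (auto simp: col_def)
  show ?case
  proof
    assume "y \<notin> beads (x # xs)"
    then obtain j where j: "y + col xs j = j + length xs" and y: "y \<noteq> x + length xs"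
      using IH by auto
    show "\<exists>j. y + col (x # xs) j = j + length (x # xs)"
    proof (cases "j < x")
      case True
      then show ?thesis using j c by (intro exI[of _ j]) simp
    next
      case False
      \<comment> \<open>From column x on, both column lengths vanish, so the extra row is
        compensated by moving one column to the left.\<close>
      then have "y = j + length xs" using j 0 by simp
      with y False have "j - 1 \<ge> x" "y = (j - 1) + length (x # xs)" by auto
      then show ?thesis by (intro exI[of _ "j - 1"]) (simp add: c)
    qed
  next
    assume "\<exists>j. y + col (x # xs) j = j + length (x # xs)"
    then obtain j where j: "y + col (x # xs) j = j + length (x # xs)" ..
    show "y \<notin> beads (x # xs)"
    proof (cases "j < x")
      case True
      then show ?thesis using j IH c[of j] by auto
    next
      case False
      then have "y = j + Suc (length xs)" using j by (simp add: c)
      then have "y + col xs (Suc j) = Suc j + length xs" "y > x + length xs"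
        using False 0[of "Suc j"] by auto
      then have "y \<notin> beads xs" using IH by blast
      then show ?thesis using \<open>y > x + length xs\<close> by simp
    qed
  qed
qed (simp add: col_def)

lemma Ball_cells_Cons:
  "(\<forall>(i, j)\<in>cells (x # xs). P i j) \<longleftrightarrow> (\<forall>j<x. P 0 j) \<and> (\<forall>(i, j)\<in>cells xs. P (Suc i) j)"
proof -
  have "(\<forall>(i, j)\<in>cells la. P i j) \<longleftrightarrow> (\<forall>i<length la. \<forall>j<la ! i. P i j)" for la P
    by (auto simp: cells_def)
  then show ?thesis by (simp add: All_less_Suc2)
qed

lemma hook_length_Cons_Suc: "hook_length (x # xs) (Suc i) j = hook_length xs i j"
proof -
  have "{i'. Suc i < i' \<and> i' < length (x # xs) \<and> j < (x # xs) ! i'}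
      = Suc ` {i'. i < i' \<and> i' < length xs \<and> j < xs ! i'}" (is "?A = ?B")
  proof -
    have "k \<in> ?A \<longleftrightarrow> k \<in> ?B" for k
      by (cases k) (auto simp: image_iff)
    then show ?thesis by blast
  qed
  then show ?thesis
    by (simp add: hook_length_def card_image)
qed

lemma hook_length_Cons_0: "hook_length (x # xs) 0 j = (x - j) + col xs j"
proof -
  have "{i'. 0 < i' \<and> i' < length (x # xs) \<and> j < (x # xs) ! i'}
      = Suc ` {i'. i' < length xs \<and> j < xs ! i'}" (is "?A = ?B")
  proof -
    have "k \<in> ?A \<longleftrightarrow> k \<in> ?B" for k
      by (cases k) (auto simp: image_iff)
    then show ?thesis by blast
  qed
  then show ?thesis
    by (simp add: hook_length_def card_image col_def length_filter_conv_card)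
qed

text \<open>A row added on top leaves the hooks of the lower rows unchanged. The new row has a hook
  of length d exactly when d places below its bead there is a gap of
  \<open>beads xs\<close>.\<close>

lemma is_t_core_Cons:
  "is_t_core t (x # xs) \<longleftrightarrow> is_t_core t xs \<and> 0 < x \<and> (\<forall>y\<in>set xs. y \<le> x) \<and>
     (\<forall>d. t dvd d \<longrightarrow> 0 < d \<longrightarrow> d \<le> x + length xs \<longrightarrow> x + length xs - d \<in> beads xs)"
proof -
  have "(\<forall>j<x. \<not> t dvd x - j + col xs j) \<longleftrightarrow>
     (\<forall>d. t dvd d \<longrightarrow> 0 < d \<longrightarrow> d \<le> x + length xs \<longrightarrow> x + length xs - d \<in> beads xs)"
    (is "?L \<longleftrightarrow> ?R") if p: "is_partition xs" and x: "\<forall>y\<in>set xs. y \<le> x"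
  proof
    assume ?L
    show ?R
    proof (intro allI impI, rule ccontr)
      fix d
      assume d: "t dvd d" "0 < d" "d \<le> x + length xs" "x + length xs - d \<notin> beads xs"
      then obtain j where j: "x + length xs - d + col xs j = j + length xs"
        using not_in_beads_iff[OF p] by blast
      have "j < x"
      proof (rule ccontr)
        assume "\<not> j < x"
        then have "col xs j = 0" using x by (intro col_eq_0) auto
        with j d \<open>\<not> j < x\<close> show False by linarith
      qed
      moreover have "x - j + col xs j = d" using j d \<open>j < x\<close> by linarith
      ultimately show False using \<open>?L\<close> d by blast
    qed
  next
    assume ?R
    show ?L
    proof (intro allI impI notI)
      fix j
      assume j: "j < x" "t dvd x - j + col xs j"
      have le: "col xs j \<le> length xs" by (simp add: col_def)
      have "x + length xs - (x - j + col xs j) \<in> beads xs"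
        using \<open>?R\<close> j le by auto
      moreover have "x + length xs - (x - j + col xs j) + col xs j = j + length xs"
        using j le by linarith
      ultimately show False using not_in_beads_iff[OF p] by blast
    qed
  qed
  then show ?thesis
    unfolding is_t_core_def is_partition_Cons Ball_cells_Cons hook_length_Cons_Suc hook_length_Cons_0
    by argo
qed

text \<open>Repeated steps of t reach every multiple of t, so closure under a single step
  suffices.\<close>

lemma is_t_core_iff_beads:
  assumes "t > 0"
  shows "is_t_core t la \<longleftrightarrow> is_partition la \<and> (\<forall>h\<in>beads la. h \<ge> t \<longrightarrow> h - t \<in> beads la)"
proof (induction la)
  case Nil
  then show ?case by (simp add: is_t_core_def is_partition_def cells_def)
next
  case (Cons x xs)
  show ?case
  proof (cases "is_partition (x # xs)")
    case False
    then show ?thesis by (simp add: is_t_core_def)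
  next
    case True
    then have p: "is_partition xs" "0 < x" "\<forall>y\<in>set xs. y \<le> x"
      by (simp_all add: is_partition_Cons)
    define h where "h = x + length xs"
    have lt: "g < h" if "g \<in> beads xs" for g
      using beads_less[OF p(3) that] by (simp add: h_def)
    have "(\<forall>d. t dvd d \<longrightarrow> 0 < d \<longrightarrow> d \<le> h \<longrightarrow> h - d \<in> beads xs) \<longleftrightarrow> (h \<ge> t \<longrightarrow> h - t \<in> beads xs)"
      if c: "\<forall>h\<in>beads xs. h \<ge> t \<longrightarrow> h - t \<in> beads xs"
    proof (intro iffI allI impI)
      fix d
      assume 1: "h \<ge> t \<longrightarrow> h - t \<in> beads xs" and d: "t dvd d" "0 < d" "d \<le> h"
      have "t * Suc k \<le> h \<Longrightarrow> h - t * Suc k \<in> beads xs" for k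
      proof (induction k)
        case (Suc k)
        then have "h - t * Suc k \<in> beads xs" "h - t * Suc k \<ge> t"
          by auto
        then have "h - t * Suc k - t \<in> beads xs" using c by blast
        then show ?case by (simp add: diff_diff_left add.commute)
      qed (use 1 in auto)
      moreover obtain k where "d = t * k" using d by blast
      ultimately show "h - d \<in> beads xs" using d by (cases k) auto
    qed (use assms in auto)
    then have "is_t_core t (x # xs) \<longleftrightarrow>
        (\<forall>h\<in>beads xs. h \<ge> t \<longrightarrow> h - t \<in> beads xs) \<and> (h \<ge> t \<longrightarrow> h - t \<in> beads xs)"
      using p Cons unfolding is_t_core_Cons h_def[symmetric] by blast
    also have "\<dots> \<longleftrightarrow> (\<forall>g\<in>insert h (beads xs). g \<ge> t \<longrightarrow> g - t \<in> insert h (beads xs))"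
    \<comment> \<open>The new bead h is the largest, so subtracting t never lands on it.\<close>
    proof -
      have "g - t \<noteq> h" if "g \<in> insert h (beads xs)" "g \<ge> t" for g
        using that lt[of g] assms by auto
      then show ?thesis by blast
    qed
    finally show ?thesis
      using True by (simp add: h_def)
  qed
qed

section \<open>Partitions recovered from their bead sets\<close>

lemma finite_beads [simp]: "finite (beads la)"
  by (induction la) auto

lemma zero_notin_beads: "is_partition la \<Longrightarrow> 0 \<notin> beads la"
  by (induction la) (auto simp: is_partition_Cons)

lemma card_beads: "is_partition la \<Longrightarrow> card (beads la) = length la"
proof (induction la)
  case (Cons x xs)
  then have "x + length xs \<notin> beads xs"
    using beads_less[of xs x] by (auto simp: is_partition_Cons)
  then show ?case using Cons by (simp add: is_partition_Cons)
qed simp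

lemma sum_beads:
  "is_partition la \<Longrightarrow> \<Sum>(beads la) = sum_list la + \<Sum>{..<length la}"
proof (induction la)
  case (Cons x xs)
  then have "x + length xs \<notin> beads xs"
    using beads_less[of xs x] by (auto simp: is_partition_Cons)
  then show ?case using Cons by (simp add: is_partition_Cons)
qed simp

lemma Max_beads_Cons:
  assumes "is_partition (x # xs)"
  shows "Max (beads (x # xs)) = x + length xs" and "beads (x # xs) - {x + length xs} = beads xs"
  using assms beads_less[of xs x]
  by (auto intro!: Max_eqI simp: is_partition_Cons less_imp_le)

text \<open>The largest bead belongs to the first row and the others form the bead set of the
  remaining rows, so the partition can be read off row by row.\<close>

lemma inj_on_beads: "inj_on beads {la. is_partition la}"
proof -
  have "is_partition la \<Longrightarrow> is_partition mu \<Longrightarrow> beads la = beads mu \<Longrightarrow> la = mu" for la mu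
  proof (induction la arbitrary: mu)
    case Nil
    then show ?case by (cases mu) auto
  next
    case (Cons x xs)
    then obtain y ys where mu: "mu = y # ys" by (cases mu) auto
    have "x + length xs = y + length ys" "beads xs = beads ys"
      using Max_beads_Cons[of x xs] Max_beads_Cons[of y ys] Cons(2-4) unfolding mu by metis+
    moreover from this have "xs = ys" using Cons mu by (simp add: is_partition_Cons)
    ultimately show ?case by (simp add: mu)
  qed
  then show ?thesis by (auto intro: inj_onI)
qed

lemma ex_beads_eq:
  assumes "finite X" "0 \<notin> X"
  shows "\<exists>la. is_partition la \<and> beads la = X"
  using assms
proof (induction X rule: finite_linorder_max_induct)
  case empty
  show ?case by (rule exI[of _ "[]"]) (simp add: is_partition_def)
next
  case (insert m X)
  then obtain la where la: "is_partition la" "beads la = X" by auto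
  \<comment> \<open>These bounds make \<open>m - length la\<close>, the new first row, positive and
    no shorter than the rows below it.\<close>
  have len: "length la \<le> m" "\<forall>y\<in>set la. y + length la \<le> m" "length la < m"
  proof -
    show *: "\<forall>y\<in>set la. y + length la \<le> m"
    proof (cases la)
      case (Cons x xs)
      then have "x + length xs < m" using la insert by auto
      then show ?thesis using la Cons by (auto simp: is_partition_Cons)
    qed simp
    show "length la < m"
    proof (cases la)
      case Nil
      then show ?thesis using insert by auto
    next
      case (Cons x xs)
      then show ?thesis using * la by (auto simp: is_partition_Cons)
    qed
    then show "length la \<le> m" by simp
  qed
  then show ?case using la
    by (intro exI[of _ "(m - length la) # la"]) (auto simp: is_partition_Cons)
qed

section \<open>3-cores as pairs of runner lengths\<close>

text \<open>An abacus with three runners and all beads pushed down. The runner of the multiples of 3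
  is empty: a bead on it could slide to 0, which is never a bead.\<close>

definition bead_runners :: "nat \<times> nat \<Rightarrow> nat set" where
  "bead_runners = (\<lambda>(i, j). (\<lambda>k. 3 * k + 1) ` {..<i} \<union> (\<lambda>k. 3 * k + 2) ` {..<j})"

lemma inj_bead_runners: "inj bead_runners"
proof (rule injI)
  fix u v :: "nat \<times> nat"
  assume eq: "bead_runners u = bead_runners v"
  have "{k. 3 * k + 1 \<in> bead_runners w} = {..<fst w}" "{k. 3 * k + 2 \<in> bead_runners w} = {..<snd w}" for w
    by (cases w; auto simp: bead_runners_def image_iff; presburger)+
  with eq have "{..<fst u} = {..<fst v}" "{..<snd u} = {..<snd v}" by metis+
  then show "u = v" by (simp add: prod_eq_iff)
qed

lemma bead_runners_closed: "h \<in> bead_runners w \<Longrightarrow> 3 \<le> h \<Longrightarrow> h - 3 \<in> bead_runners w"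
proof -
  assume h: "h \<in> bead_runners w" "3 \<le> h"
  obtain i j where w: "w = (i, j)" by fastforce
  consider k where "k < i" "h = 3 * k + 1" | k where "k < j" "h = 3 * k + 2"
    using h w by (auto simp: bead_runners_def)
  then show ?thesis
  proof cases
    case 1
    then have "h - 3 = 3 * (k - 1) + 1" "k - 1 < i" using h by auto
    then show ?thesis by (auto simp: w bead_runners_def)
  next
    case 2
    then have "h - 3 = 3 * (k - 1) + 2" "k - 1 < j" using h by auto
    then show ?thesis by (auto simp: w bead_runners_def)
  qed
qed

lemma down_closed_nat:
  assumes "finite D" "\<And>k. Suc k \<in> D \<Longrightarrow> k \<in> D"
  shows "\<exists>n :: nat. D = {..<n}"
proof -
  obtain m where m: "m \<notin> D" using assms(1) ex_new_if_finite infinite_UNIV_nat by blast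
  define n where "n = (LEAST m. m \<notin> D)"
  have n: "n \<notin> D" "\<And>k. k < n \<Longrightarrow> k \<in> D"
    unfolding n_def using LeastI[of "\<lambda>m. m \<notin> D", OF m] not_less_Least by blast+
  have "k \<notin> D" if "n \<le> k" for k
    using that by (induction rule: dec_induct) (use n assms(2) in auto)
  with n show ?thesis by (intro exI[of _ n]) (auto simp: not_less[symmetric])
qed

lemma closed_eq_bead_runners:
  assumes "finite X" "0 \<notin> X" and closed: "\<And>h. h \<in> X \<Longrightarrow> 3 \<le> h \<Longrightarrow> h - 3 \<in> X"
  shows "X \<in> range bead_runners"
proof -
  have D: "\<exists>n. {k. 3 * k + r \<in> X} = {..<n}" for r
  proof (rule down_closed_nat)
    show "finite {k. 3 * k + r \<in> X}"
      using finite_vimageI[OF assms(1), of "\<lambda>k. 3 * k + r"] by (simp add: vimage_def inj_on_def)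
    show "k \<in> {k. 3 * k + r \<in> X}" if "Suc k \<in> {k. 3 * k + r \<in> X}" for k
      using closed[of "3 * Suc k + r"] that by (simp add: algebra_simps)
  qed
  obtain i j l where i: "{k. 3 * k + 1 \<in> X} = {..<i}" and j: "{k. 3 * k + 2 \<in> X} = {..<j}"
    and l: "{k. 3 * k + 0 \<in> X} = {..<l}"
    using D[of 1] D[of 2] D[of 0] by blast
  have "l = 0"
  proof (rule ccontr)
    assume "l \<noteq> 0"
    then have "0 \<in> {k. 3 * k + 0 \<in> X}" unfolding l by simp
    then show False using assms(2) by simp
  qed
  have "h \<in> X \<longleftrightarrow> h \<in> bead_runners (i, j)" for h
  proof -
    consider k where "h = 3 * k + 0" | k where "h = 3 * k + 1" | k where "h = 3 * k + 2"
      using that by (metis One_nat_def add_0 mod_less_divisor mult_div_mod_eq numeral_2_eq_2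
          less_Suc_eq less_zeroE numeral_3_eq_3 zero_less_Suc)
    then show ?thesis
    proof cases
      case 1
      then show ?thesis using l \<open>l = 0\<close> by (auto simp: bead_runners_def) presburger+
    next
      case 2
      then have "h \<in> X \<longleftrightarrow> k < i" using i by blast
      then show ?thesis using 2 by (auto simp: bead_runners_def image_iff) presburger
    next
      case 3
      then have "h \<in> X \<longleftrightarrow> k < j" using j by blast
      then show ?thesis using 3 by (auto simp: bead_runners_def image_iff) presburger
    qed
  qed
  then show ?thesis by blast
qed

lemma bead_runners_simps [simp]: "finite (bead_runners w)" "0 \<notin> bead_runners w"
  by (auto simp: bead_runners_def split: prod.splits)

lemma card_bead_runners: "card (bead_runners (i, j)) = i + j"
  and sum_bead_runners: "2 * \<Sum>(bead_runners (i, j)) + i = 3 * i\<^sup>2 + 3 * j\<^sup>2 + j"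
proof -
  have d: "(\<lambda>k. 3 * k + 1) ` {..<i} \<inter> (\<lambda>k. 3 * k + 2) ` {..<j} = {}"
    by auto presburger
  have inj: "inj_on (\<lambda>k. 3 * k + 1) {..<i}" "inj_on (\<lambda>k. 3 * k + 2) {..<j}"
    by (auto simp: inj_on_def)
  show "card (bead_runners (i, j)) = i + j"
    using d inj by (simp add: bead_runners_def card_Un_disjoint card_image)
  have "2 * (\<Sum>k<i. 3 * k + 1) + i = 3 * i\<^sup>2"
    by (induction i) (simp_all add: power2_eq_square)
  moreover have "2 * (\<Sum>k<j. 3 * k + 2) = 3 * j\<^sup>2 + j"
    by (induction j) (simp_all add: power2_eq_square)
  moreover have "\<Sum>(bead_runners (i, j)) = (\<Sum>k<i. 3 * k + 1) + (\<Sum>k<j. 3 * k + 2)"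
    using d inj by (simp add: bead_runners_def sum.union_disjoint sum.reindex)
  ultimately show "2 * \<Sum>(bead_runners (i, j)) + i = 3 * i\<^sup>2 + 3 * j\<^sup>2 + j"
    by (simp add: algebra_simps)
qed

text \<open>The size is the bead sum minus the triangular number 0 + ... + (i + j - 1). The product
  stands on the left to avoid subtraction of natural numbers.\<close>

lemma sum_list_if_beads_eq_bead_runners:
  assumes "is_partition la" "beads la = bead_runners (i, j)"
  shows "sum_list la + i * j = i\<^sup>2 + j\<^sup>2 + j"
proof -
  have len: "length la = i + j" using card_beads[OF assms(1)] assms(2) card_bead_runners by simp
  have g: "2 * \<Sum>{..<m} + m = m\<^sup>2" for m :: nat
    by (induction m) (simp_all add: power2_eq_square)
  show ?thesis
    using sum_beads[OF assms(1)] sum_bead_runners[of i j] g[of "i + j"] unfolding len assms(2)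
    by (simp add: power2_eq_square algebra_simps)
qed

lemma bij_betw_cores:
  "bij_betw beads {la. is_t_core 3 la \<and> sum_list la = n}
     (bead_runners ` {(i, j). i\<^sup>2 + j\<^sup>2 + j = n + i * j})"
proof (rule bij_betw_imageI)
  show "inj_on beads {la. is_t_core 3 la \<and> sum_list la = n}"
    by (rule inj_on_subset[OF inj_on_beads]) (auto simp: is_t_core_def)
  show "beads ` {la. is_t_core 3 la \<and> sum_list la = n} = bead_runners ` {(i, j). i\<^sup>2 + j\<^sup>2 + j = n + i * j}"
  proof (intro equalityI subsetI)
    fix X
    assume "X \<in> beads ` {la. is_t_core 3 la \<and> sum_list la = n}"
    then obtain la where X: "X = beads la" and la: "is_t_core 3 la" "sum_list la = n" by blast
    then have p: "is_partition la" by (simp add: is_t_core_def)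
    have "X \<in> range bead_runners"
      using la p zero_notin_beads[OF p] unfolding X by (intro closed_eq_bead_runners) (auto simp: is_t_core_iff_beads)
    then obtain i j where ij: "X = bead_runners (i, j)" by auto
    then have "i\<^sup>2 + j\<^sup>2 + j = n + i * j"
      using sum_list_if_beads_eq_bead_runners[OF p] X la by simp
    then show "X \<in> bead_runners ` {(i, j). i\<^sup>2 + j\<^sup>2 + j = n + i * j}" using ij by blast
  next
    fix X
    assume "X \<in> bead_runners ` {(i, j). i\<^sup>2 + j\<^sup>2 + j = n + i * j}"
    then obtain i j where X: "X = bead_runners (i, j)" and ij: "i\<^sup>2 + j\<^sup>2 + j = n + i * j" by blast
    obtain la where la: "is_partition la" "beads la = X"
      using ex_beads_eq[of X] X by auto
    then have "sum_list la + i * j = n + i * j"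
      using sum_list_if_beads_eq_bead_runners[of la i j] X ij by simp
    moreover have "is_t_core 3 la"
      using la bead_runners_closed unfolding X by (auto simp: is_t_core_iff_beads)
    ultimately show "X \<in> beads ` {la. is_t_core 3 la \<and> sum_list la = n}"
      using la by auto
  qed
qed

lemma card_cores:
  "card {la. is_t_core 3 la \<and> sum_list la = n} = card {(i, j). i\<^sup>2 + j\<^sup>2 + j = n + i * j}"
  using bij_betw_same_card[OF bij_betw_cores, of n]
  by (simp add: card_image inj_on_subset[OF inj_bead_runners])

subsection \<open>Cores and Eisenstein integers\<close>

definition eis_norm :: "int \<times> int \<Rightarrow> int" where
  "eis_norm = (\<lambda>(a, b). a\<^sup>2 - a * b + b\<^sup>2)"

definition bead_counts :: "nat \<Rightarrow> (nat \<times> nat) set" where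
  "bead_counts n = {(i, j). i\<^sup>2 + j\<^sup>2 + j = n + i * j}"

text \<open>The equation of \<open>bead_counts\<close> on the whole lattice, where its solutions
  admit a rotation of order 3.\<close>

definition core_points :: "nat \<Rightarrow> (int \<times> int) set" where
  "core_points n = {(i, j). i\<^sup>2 - i * j + j\<^sup>2 + j = int n}"

definition eis_points :: "nat \<Rightarrow> (int \<times> int) set" where
  "eis_points n = {u. eis_norm u = 3 * int n + 1}"

lemma finite_eis_points: "finite (eis_points n)"
  by (rule finite_subset[OF _ finite_eisenstein_norm[of "3 * int n + 1"]])
     (auto simp: eis_points_def eis_norm_def)

text \<open>\<open>f (i, j) = 1 - \<theta> (i + j \<omega>)\<close> with \<open>\<theta> = 1 + 2 \<omega> = \<surd>-3\<close>, and \<open>g = - f\<close>: an Eisenstein integer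
that \<open>\<theta>\<close> does not divide is \<open>\<plusminus>1\<close> modulo \<open>\<theta>\<close>.\<close>
lemma eis_points_eq:
  defines "f \<equiv> \<lambda>(i :: int, j :: int). (1 - i + 2 * j, j - 2 * i)"
  defines "g \<equiv> \<lambda>(i :: int, j :: int). (i - 2 * j - 1, 2 * i - j)"
  shows "eis_points n = f ` core_points n \<union> g ` core_points n"
    and "f ` core_points n \<inter> g ` core_points n = {}"
    and "inj f" "inj g"
proof -
  have f: "eis_norm (f (i, j)) = 3 * (i\<^sup>2 - i * j + j\<^sup>2 + j) + 1"
   and g: "eis_norm (g (i, j)) = 3 * (i\<^sup>2 - i * j + j\<^sup>2 + j) + 1" for i j
    by (simp_all add: f_def g_def eis_norm_def power2_eq_square algebra_simps)
  show "inj f" "inj g"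
    by (auto simp: f_def g_def inj_def)
  show "f ` core_points n \<inter> g ` core_points n = {}"
    by (auto simp: f_def g_def) presburger
  show "eis_points n = f ` core_points n \<union> g ` core_points n"
  proof (intro equalityI subsetI)
    fix u assume "u \<in> eis_points n"
    then obtain a b where u: "u = (a, b)" and ab: "a\<^sup>2 - a * b + b\<^sup>2 = 3 * int n + 1"
      by (cases u) (auto simp: eis_points_def eis_norm_def)
    \<comment> \<open>The residue of a + b modulo 3 is 1 on the image of \<open>f\<close> and - 1 on
      that of \<open>g\<close>, so it decides which map to invert.\<close>
    have "(a + b)\<^sup>2 = 3 * (int n + a * b) + 1"
      using ab by (simp add: power2_eq_square algebra_simps)
    then have "(a + b)\<^sup>2 mod 3 = 1" by presburger
    then have "(a + b) mod 3 \<noteq> 0"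
      by (metis mod_0 power_mod zero_neq_one zero_power2)
    then have "(\<exists>k. a + b = 3 * k + 1) \<or> (\<exists>k. a + b = 3 * k - 1)" by presburger
    then consider k where "a + b = 3 * k + 1" | k where "a + b = 3 * k - 1" by blast
    then show "u \<in> f ` core_points n \<union> g ` core_points n"
    proof cases
      case 1
      then have "u = f (k - b, 2 * k - b)" by (simp add: u f_def)
      moreover from this have "(k - b, 2 * k - b) \<in> core_points n"
        using f[of "k - b" "2 * k - b"] ab
        by (simp add: core_points_def flip: \<open>u = f (k - b, 2 * k - b)\<close>) (simp add: u eis_norm_def)
      ultimately show ?thesis by blast
    next
      case 2
      then have "u = g (b - k, b - 2 * k)" by (simp add: u g_def)
      moreover from this have "(b - k, b - 2 * k) \<in> core_points n"
        using g[of "b - k" "b - 2 * k"] ab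
        by (simp add: core_points_def flip: \<open>u = g (b - k, b - 2 * k)\<close>) (simp add: u eis_norm_def)
      ultimately show ?thesis by blast
    qed
  qed (use f g in \<open>auto simp: eis_points_def core_points_def\<close>)
qed

text \<open>In the coordinates \<open>1 - \<theta> (i + j \<omega>)\<close>, multiplication by \<open>\<omega>\<close> is
\<open>(i, j) \<mapsto> (- 1 - j, i - j - 1)\<close>; \<open>h1\<close> and \<open>h2\<close> are the
rotations of the quadrant \<open>h0\<close>.\<close>
lemma core_points_eq:
  defines "h0 \<equiv> \<lambda>(i :: nat, j :: nat). (int i, int j)"
  defines "h1 \<equiv> \<lambda>(i :: nat, j :: nat). (- 1 - int j, int i - int j - 1)"
  defines "h2 \<equiv> \<lambda>(i :: nat, j :: nat). (int j - int i, - 1 - int i)"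
  shows "core_points n = h0 ` bead_counts n \<union> (h1 ` bead_counts n \<union> h2 ` bead_counts n)"
    and "h0 ` bead_counts n \<inter> (h1 ` bead_counts n \<union> h2 ` bead_counts n) = {}"
    and "h1 ` bead_counts n \<inter> h2 ` bead_counts n = {}"
    and "inj h0" "inj h1" "inj h2"
proof -
  have b: "(i, j) \<in> bead_counts n \<longleftrightarrow> (int i)\<^sup>2 - int i * int j + (int j)\<^sup>2 + int j = int n" for i j
  proof -
    have "(i, j) \<in> bead_counts n \<longleftrightarrow> int (i\<^sup>2 + j\<^sup>2 + j) = int (n + i * j)"
      unfolding bead_counts_def of_nat_eq_iff by simp
    then show ?thesis by (auto simp: algebra_simps)
  qed
  have h: "h0 w \<in> core_points n \<longleftrightarrow> w \<in> bead_counts n" "h1 w \<in> core_points n \<longleftrightarrow> w \<in> bead_counts n"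
    "h2 w \<in> core_points n \<longleftrightarrow> w \<in> bead_counts n" for w
    by (cases w; simp add: b h0_def h1_def h2_def core_points_def power2_eq_square algebra_simps;
        fail)+
  show "inj h0" "inj h1" "inj h2"
    by (auto simp: h0_def h1_def h2_def inj_def)
  show "h0 ` bead_counts n \<inter> (h1 ` bead_counts n \<union> h2 ` bead_counts n) = {}"
    "h1 ` bead_counts n \<inter> h2 ` bead_counts n = {}"
    by (auto simp: h0_def h1_def h2_def)
  have cover: "\<exists>w. u = h0 w \<or> u = h1 w \<or> u = h2 w" for u
  proof -
    obtain i j where u: "u = (i, j)" by fastforce
    \<comment> \<open>Three sectors with half-open borders, the images of \<open>h0\<close>,
      \<open>h1\<close> and \<open>h2\<close>; the witnesses below invert these maps.\<close>
    consider "i \<ge> 0" "j \<ge> 0" | "i \<le> - 1" "j \<ge> i" | "j \<le> - 1" "i \<ge> j + 1" by linarith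
    then show ?thesis
    proof cases
      case 1
      then show ?thesis by (intro exI[of _ "(nat i, nat j)"]) (simp add: u h0_def)
    next
      case 2
      then show ?thesis by (intro exI[of _ "(nat (j - i), nat (- 1 - i))"]) (simp add: u h1_def)
    next
      case 3
      then show ?thesis by (intro exI[of _ "(nat (- 1 - j), nat (i - 1 - j))"]) (simp add: u h2_def)
    qed
  qed
  show "core_points n = h0 ` bead_counts n \<union> (h1 ` bead_counts n \<union> h2 ` bead_counts n)"
  proof (intro equalityI subsetI)
    fix u assume u: "u \<in> core_points n"
    obtain w where "u = h0 w \<or> u = h1 w \<or> u = h2 w" using cover by blast
    with u h[of w]
    show "u \<in> h0 ` bead_counts n \<union> (h1 ` bead_counts n \<union> h2 ` bead_counts n)" by auto
  qed (auto simp: h)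
qed

lemma finite_core_points: "finite (core_points n)"
  using finite_eis_points[of n] finite_image_iff[OF inj_on_subset[OF eis_points_eq(3)]]
  unfolding eis_points_eq(1)[of n] by simp

lemma finite_bead_counts: "finite (bead_counts n)"
  using finite_core_points[of n] finite_image_iff[OF inj_on_subset[OF core_points_eq(4)]]
  unfolding core_points_eq(1)[of n] by simp

lemma card_eis_points: "card (eis_points n) = 6 * card (bead_counts n)"
proof -
  have "card (eis_points n) = 2 * card (core_points n)"
    unfolding eis_points_eq(1)
    using card_Un_disjoint[OF _ _ eis_points_eq(2)] finite_core_points
    by (simp add: card_image inj_on_subset[OF eis_points_eq(3)] inj_on_subset[OF eis_points_eq(4)])
  also have "card (core_points n) = 3 * card (bead_counts n)"
    unfolding core_points_eq(1)
    using card_Un_disjoint[OF _ _ core_points_eq(2)] card_Un_disjoint[OF _ _ core_points_eq(3)] finite_bead_counts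
    by (simp add: card_image inj_on_subset[OF core_points_eq(4)] inj_on_subset[OF core_points_eq(5)]
        inj_on_subset[OF core_points_eq(6)])
  finally show ?thesis by simp
qed

section \<open>From pairs of cores to quaternions and the final formula\<close>

lemma A3_eq_sum: "A3 n = (\<Sum>k\<le>n. card (bead_counts k) * card (bead_counts (n - k)))"
proof -
  define C where "C k = {la. is_t_core 3 la \<and> sum_list la = k}" for k
  have card_C: "card (C k) = card (bead_counts k)" for k
    unfolding C_def bead_counts_def by (rule card_cores)
  have fin_C: "finite (C k)" for k
    unfolding C_def using bij_betw_finite[OF bij_betw_cores[of k]] finite_bead_counts[of k]
    unfolding bead_counts_def by simp
  have "{(l1, l2). is_t_core 3 l1 \<and> is_t_core 3 l2 \<and> sum_list l1 + sum_list l2 = n}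
      = (\<Union>k\<in>{..n}. C k \<times> C (n - k))"
    by (auto simp: C_def)
  then have "A3 n = card (\<Union>k\<in>{..n}. C k \<times> C (n - k))" by (simp add: A3_def)
  also have "\<dots> = (\<Sum>k\<in>{..n}. card (C k \<times> C (n - k)))"
    by (rule card_UN_disjoint) (use fin_C in \<open>auto simp: C_def\<close>)
  finally show ?thesis by (simp add: card_cartesian_product card_C)
qed

lemma eis_norm_mod_3: "eis_norm u mod 3 = 0 \<or> eis_norm u mod 3 = 1"
proof -
  obtain a b where u: "u = (a, b)" by fastforce
  have "eis_norm u = (a + b)\<^sup>2 + (- (a * b)) * 3"
    by (simp add: u eis_norm_def power2_eq_square algebra_simps)
  then have "eis_norm u mod 3 = ((a + b) mod 3)\<^sup>2 mod 3"
    by (simp only: mod_mult_self1 power_mod)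
  moreover have "(a + b) mod 3 \<in> {0, 1, 2}" by auto
  ultimately show ?thesis by auto
qed

text \<open>Eisenstein norms are 0 or 1 modulo 3, so two of them with sum 3 n + 2 are 3 k + 1 and 3
  (n - k) + 1. This is the convolution for \<open>A3\<close>, with a factor 6 from each
  component.\<close>

lemma card_qnorm_eq: "card {x. qnorm x = 3 * int n + 2} = 36 * A3 n"
proof -
  define F where "F = (\<lambda>((a, b), (c, d)). Quat a b c d)"
  have inj: "inj F" by (auto simp: inj_def F_def)
  have qF: "qnorm (F (u, v)) = eis_norm u + eis_norm v" for u v
    by (auto simp: F_def qnorm_def eis_norm_def split: prod.splits)
  have surj: "\<exists>u v. x = F (u, v)" for x
    by (rule exI[of _ "(qa x, qb x)"], rule exI[of _ "(qc x, qd x)"]) (simp add: F_def)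
  have "{x. qnorm x = 3 * int n + 2} = F ` (\<Union>k\<in>{..n}. eis_points k \<times> eis_points (n - k))"
  proof (intro equalityI subsetI)
    fix x assume "x \<in> {x. qnorm x = 3 * int n + 2}"
    moreover obtain u v where x: "x = F (u, v)" using surj by blast
    ultimately have uv: "eis_norm u + eis_norm v = 3 * int n + 2" by (simp add: qF)
    have nn: "eis_norm u \<ge> 0" "eis_norm v \<ge> 0"
      using eisenstein_norm_pos(1) by (auto simp: eis_norm_def split: prod.splits)
    define k where "k = nat (eis_norm u div 3)"
    have "eis_norm u mod 3 = 1"
      using uv eis_norm_mod_3[of u] eis_norm_mod_3[of v] by presburger
    moreover have "int k = eis_norm u div 3" using nn by (simp add: k_def)
    ultimately have "eis_norm u = 3 * int k + 1" by presburger
    moreover from this have "k \<le> n" "eis_norm v = 3 * int (n - k) + 1" using uv nn by auto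
    ultimately show "x \<in> F ` (\<Union>k\<in>{..n}. eis_points k \<times> eis_points (n - k))"
      unfolding x eis_points_def by blast
  qed (auto simp: eis_points_def qF)
  then have "card {x. qnorm x = 3 * int n + 2} = card (\<Union>k\<in>{..n}. eis_points k \<times> eis_points (n - k))"
    by (simp add: card_image inj_on_subset[OF inj])
  also have "\<dots> = (\<Sum>k\<in>{..n}. card (eis_points k \<times> eis_points (n - k)))"
    by (rule card_UN_disjoint) (simp, simp add: finite_eis_points, auto simp: eis_points_def)
  finally show ?thesis
    by (simp add: card_cartesian_product card_eis_points A3_eq_sum sum_distrib_left mult_ac)
qed

text \<open>Both cases of the theorem have a power of p that is 1 modulo 3. Then the division by 3
  is exact, and the new argument N satisfies 3 N + 2 = p^k (3 n + 2).\<close>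

lemma A3_prime_power:
  fixes p n k :: nat
  assumes "prime p" "p ^ k mod 3 = 1" "p \<noteq> 3" "\<not> p dvd 3 * n + 2"
  shows "real (A3 (p ^ k * n + (2 * p ^ k - 2) div 3)) = (real p ^ (k + 1) - 1) / (real p - 1) * real (A3 n)"
proof -
  define N where "N = p ^ k * n + (2 * p ^ k - 2) div 3"
  obtain c where c: "p ^ k = 3 * c + 1" using assms(2) by (metis mult_div_mod_eq)
  have "3 * N + 2 = p ^ k * (3 * n + 2)"
    by (simp add: N_def c algebra_simps)
  then have N: "3 * int N + 2 = int p ^ k * (3 * int n + 2)"
    by (metis (no_types, lifting) of_nat_add of_nat_mult of_nat_numeral of_nat_power)
  have "\<not> int p dvd 3 * int n + 2"
    using assms(4) by (metis of_nat_add of_nat_mult of_nat_numeral of_nat_dvd_iff)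
  then have "rep (int p ^ k * (3 * int n + 2)) = (\<Sum>i<k+1. nat (int p) ^ i) * rep (3 * int n + 2)"
    using assms by (intro rep_prime_power) auto
  then have "36 * A3 N = (\<Sum>i<k+1. p ^ i) * (36 * A3 n)"
    unfolding N[symmetric] rep_def card_qnorm_eq by simp
  then have "real (A3 N) = (\<Sum>i<k+1. real p ^ i) * real (A3 n)"
    by (simp flip: of_nat_mult of_nat_power of_nat_sum of_nat_add)
  moreover have "real p \<noteq> 1" using assms(1) by auto
  ultimately show ?thesis
    unfolding N_def by (subst (asm) geometric_sum) auto
qed

theorem theorem2p4:
  fixes p k n :: nat
  assumes "prime p" and "\<not> p dvd (3 * n + 2)"
  shows "(p mod 3 = 1 \<longrightarrow>
           real (A3 (p ^ k * n + (2 * p ^ k - 2) div 3))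
             = (real p ^ (k + 1) - 1) / (real p - 1) * real (A3 n))
       \<and> (p mod 3 = 2 \<longrightarrow>
           real (A3 (p ^ (2 * k) * n + (2 * p ^ (2 * k) - 2) div 3))
             = (real p ^ (2 * k + 1) - 1) / (real p - 1) * real (A3 n))"
proof (intro conjI impI)
  assume "p mod 3 = 1"
  moreover from this have "p ^ k mod 3 = 1" by (metis mod_mod_trivial power_mod power_one)
  ultimately show "real (A3 (p ^ k * n + (2 * p ^ k - 2) div 3))
             = (real p ^ (k + 1) - 1) / (real p - 1) * real (A3 n)"
    using assms by (intro A3_prime_power) auto
next
  assume "p mod 3 = 2"
  moreover from this have "p\<^sup>2 mod 3 = 1" by (simp add: power_mod[of p 3 2, symmetric])
  then have "p ^ (2 * k) mod 3 = 1"
    unfolding power_mult by (metis mod_mod_trivial power_mod power_one)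
  ultimately show "real (A3 (p ^ (2 * k) * n + (2 * p ^ (2 * k) - 2) div 3))
             = (real p ^ (2 * k + 1) - 1) / (real p - 1) * real (A3 n)"
    using assms by (intro A3_prime_power) auto
qed

end
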